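(* Let $M$ be a closed subset of a Banach space $E$. The following two assertions are equivalent: (i) $M$ is epi-Lipschitzian; (ii) there is a locally Lipschitz function $f:E\to\mathbb{R}$ such that $$M=\{x \mid f(x)\le 0\}\quad\text{(set representation)}$$ and $$0\notin\partial f(x)\ \text{ if } x\in \operatorname{bd} M\quad\text{(nondegeneracy)}.$$
   Context: $\operatorname{bd} M$ denotes the topological boundary of $M$ in $E$. Epi-Lipschitzian sets: a subset $M$ of a Banach space $E$ is epi-Lipschitzian at $x\in M$ if and only if there exist a neighborhood $U$ of $x$, a Banach space $F$, a Banach isomorphism (bijective linear map, continuous with continuous inverse) $A:E\to F\times\mathbb{R}$, and a map $\Phi:F\to\mathbb{R}$ which is Lipschitz around the $F$-component of $A(x)$, such that $M\cap U=U\cap A^{-1}(\operatorname{epi}\Phi)$, where $\operatorname{epi}\Phi=\{(\xi,t)\mid \Phi(\xi)\le t\}$. The set $M$ is epi-Lipschitzian if it is epi-Lipschitzian at every $x\in M$. Clarke's generalized gradient: for a locally Lipschitz function $f:E\to\mathbb{R}$, $x\in E$, $v\in E$, the generalized directional derivative of $f$ at $x$ in the direction $v$ is $$f^0(x,v)=\limsup_{y\to x,\ t>0,\ t\to 0}\frac{f(y+tv)-f(y)}{t},$$ and the generalized gradient of $f$ at $x$ is the set $\partial f(x)=\{\xi\in E^*\mid \forall v\in E,\ f^0(x,v)\ge\langle\xi,v\rangle\}$, where $E^*$ is the topological dual of $E$.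
   Formalization: The Banach space E is assumed to be nonzero: for E = {0} and M = E, assertion (ii) holds with f = 0 since bd M is empty, but (i) fails because {0} is not isomorphic to any F × R. *)

theory Defs
  imports "HOL-Analysis.Analysis"
begin

definition lipschitz_around ::
    "'a::metric_space set \<Rightarrow> ('a \<Rightarrow> 'b::metric_space) \<Rightarrow> 'a \<Rightarrow> bool" where
  "lipschitz_around S f x \<longleftrightarrow> (\<exists>e>0. \<exists>L. L-lipschitz_on (ball x e \<inter> S) f)"

definition locally_lipschitz :: "('a::metric_space \<Rightarrow> 'b::metric_space) \<Rightarrow> bool" where
  "locally_lipschitz f \<longleftrightarrow> (\<forall>x. lipschitz_around UNIV f x)"

text \<open>
  Existential quantification over a type is not available in HOL, so the Banach space in the
  definition of an epi-Lipschitzian set is represented by a complete linear subspace \<open>F\<close> of some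
  normed space; \<open>F = UNIV\<close> is the case of a Banach space that is a type of class \<open>banach\<close>.
\<close>

definition epi_lipschitzian_at_via ::
    "'f::real_normed_vector set \<Rightarrow> 'a::real_normed_vector set \<Rightarrow> 'a \<Rightarrow> bool" where
  "epi_lipschitzian_at_via F M x \<longleftrightarrow>
     subspace F \<and> complete F \<and>
     (\<exists>(U :: 'a set) (A :: 'a \<Rightarrow> 'f \<times> real) B (\<Phi> :: 'f \<Rightarrow> real).
        x \<in> interior U \<and>
        linear A \<and> homeomorphism UNIV (F \<times> UNIV) A B \<and>
        lipschitz_around F \<Phi> (fst (A x)) \<and>
        M \<inter> U = U \<inter> A -` epigraph F \<Phi>)"

text \<open>
  Taking \<open>F\<close> inside the ambient space loses no generality: see
  \<open>epi_lipschitzian_at_if_via\<close> below.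
\<close>

definition epi_lipschitzian_at :: "'a::banach set \<Rightarrow> 'a \<Rightarrow> bool" where
  "epi_lipschitzian_at M x \<longleftrightarrow> (\<exists>F :: 'a set. epi_lipschitzian_at_via F M x)"

definition epi_lipschitzian :: "'a::banach set \<Rightarrow> bool" where
  "epi_lipschitzian M \<longleftrightarrow> (\<forall>x\<in>M. epi_lipschitzian_at M x)"

lemma epi_lipschitzian_at_if_via:
  fixes F :: "'f::real_normed_vector set" and M :: "'a::banach set"
  assumes "epi_lipschitzian_at_via F M x"
  shows "epi_lipschitzian_at M x"
proof -
  obtain U and A :: "'a \<Rightarrow> 'f \<times> real" and B \<Phi> where
    F: "subspace F" and U: "x \<in> interior U" and A: "linear A"
    and hom: "homeomorphism UNIV (F \<times> UNIV) A B"
    and lip: "lipschitz_around F \<Phi> (fst (A x))"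
    and M: "M \<inter> U = U \<inter> A -` epigraph F \<Phi>"
    using assms unfolding epi_lipschitzian_at_via_def by blast
  have contA: "continuous_on UNIV A" and contB: "continuous_on (F \<times> UNIV) B"
    and BA: "\<And>y. B (A y) = y" and AB: "\<And>p. p \<in> F \<times> UNIV \<Longrightarrow> A (B p) = p"
    and rangeA: "\<And>y. A y \<in> F \<times> UNIV"
    using hom unfolding homeomorphism_def by auto
  have blA: "bounded_linear A"
  proof -
    have "isCont A 0"
      using contA continuous_on_eq_continuous_at open_UNIV by blast
    then obtain d where d: "d > 0" "\<And>y. norm y < d \<Longrightarrow> norm (A y) < 1"
      using linear_0[OF A] by (auto simp: continuous_at_eps_delta dist_norm dest: spec[of _ 1])
    have "norm (A y) \<le> norm y * (2 / d)" for y
    proof (cases "y = 0")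
      case True
      then show ?thesis using linear_0[OF A] by simp
    next
      case False
      define c where "c = d / (2 * norm y)"
      have c: "c > 0" using False d by (simp add: c_def)
      have "norm (c *\<^sub>R y) < d" using False d by (simp add: c_def)
      from d(2)[OF this] have "c * norm (A y) < 1"
        using c by (simp add: linear_cmul[OF A])
      then show ?thesis using c False d by (simp add: c_def field_simps)
    qed
    then show ?thesis using A by (intro bounded_linear_intro[where K = "2 / d"]) (simp_all add: linear_add linear_cmul)
  qed
  define G where "G = {y. snd (A y) = 0}"
  define A' where "A' = (\<lambda>y. (B (fst (A y), 0), snd (A y)))"
  define B' where "B' = (\<lambda>p. B (fst (A (fst p)), snd p))"
  define \<Psi> where "\<Psi> = \<Phi> \<circ> fst \<circ> A"
  have memF: "fst (A y) \<in> F" for y using rangeA[of y] by auto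
  have AB': "A (B (fst (A y), t)) = (fst (A y), t)" for y t using AB memF by auto
  have G: "subspace G"
    unfolding subspace_def G_def
    using linear_0[OF A] linear_add[OF A] linear_cmul[OF A] by auto
  have "closed G"
    unfolding G_def by (intro closed_Collect_eq continuous_intros contA)
  then have Gc: "complete G" by (simp add: complete_eq_closed)
  have Binj: "p = q" if "A p = A q" for p q using BA that by metis
  have "linear (\<lambda>y. B (fst (A y), 0))"
    by (rule linearI; rule Binj) (simp_all add: AB memF subspace_add[OF F] subspace_scale[OF F] linear_add[OF A] linear_cmul[OF A])
  then have linA': "linear A'"
    unfolding A'_def
    by (auto intro!: linearI simp: linear_add[OF A] linear_cmul[OF A] dest: linear_add linear_cmul)
  have homA': "homeomorphism UNIV (G \<times> UNIV) A' B'"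
  proof (rule homeomorphismI)
    show "continuous_on UNIV A'"
      unfolding A'_def using memF
      by (intro continuous_intros continuous_on_compose2[OF contB] contA) auto
    show "continuous_on (G \<times> UNIV) B'"
      unfolding B'_def using memF
      by (intro continuous_on_compose2[OF contB] continuous_intros continuous_on_compose2[OF contA])
        auto
    show "A' ` UNIV \<subseteq> G \<times> UNIV"
      by (auto simp: A'_def G_def AB')
    show "B' (A' y) = y" for y
      by (simp add: A'_def B'_def AB' BA)
    show "A' (B' p) = p" if "p \<in> G \<times> UNIV" for p
    proof -
      have "B (fst (A (fst p)), 0) = fst p"
        using that BA[of "fst p"] by (cases "A (fst p)") (auto simp: G_def)
      then show ?thesis by (simp add: A'_def B'_def AB')
    qed
  qed simp
  have lip': "lipschitz_around G \<Psi> (fst (A' x))"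
  proof -
    obtain e L where e: "e > 0" and L: "L-lipschitz_on (ball (fst (A x)) e \<inter> F) \<Phi>"
      using lip unfolding lipschitz_around_def by blast
    obtain K where K: "K > 0" "\<And>y. norm (A y) \<le> norm y * K"
      using bounded_linear.pos_bounded[OF blA] by blast
    have KD: "dist (fst (A y)) (fst (A z)) \<le> K * dist y z" for y z
      using order_trans[OF dist_fst_le[of "A y" "A z"]] K(2)[of "y - z"]
      by (simp add: dist_norm linear_diff[OF A] mult.commute)
    have x: "fst (A (fst (A' x))) = fst (A x)" by (simp add: A'_def AB')
    have ball: "fst (A y) \<in> ball (fst (A x)) e \<inter> F" if "y \<in> ball (fst (A' x)) (e / K)" for y
    proof -
      have "K * dist (fst (A' x)) y < e" using that K(1) by (simp add: field_simps)
      then have "dist (fst (A x)) (fst (A y)) < e" using KD[of "fst (A' x)" y] x by simp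
      then show ?thesis using memF by simp
    qed
    have "(L * K)-lipschitz_on (ball (fst (A' x)) (e / K) \<inter> G) \<Psi>"
    proof (rule lipschitz_onI)
      have L0: "0 \<le> L" using L by (rule lipschitz_on_nonneg)
      then show "0 \<le> L * K" using K(1) by simp
      fix y z assume "y \<in> ball (fst (A' x)) (e / K) \<inter> G" "z \<in> ball (fst (A' x)) (e / K) \<inter> G"
      then have "dist (\<Psi> y) (\<Psi> z) \<le> L * dist (fst (A y)) (fst (A z))"
        using lipschitz_onD[OF L ball ball, of y z] by (simp add: \<Psi>_def)
      also have "\<dots> \<le> L * (K * dist y z)" using KD L0 by (intro mult_left_mono)
      finally show "dist (\<Psi> y) (\<Psi> z) \<le> L * K * dist y z" by (simp add: mult.assoc)
    qed
    moreover have "e / K > 0" using e K(1) by simp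
    ultimately show ?thesis unfolding lipschitz_around_def by blast
  qed
  have "A -` epigraph F \<Phi> = A' -` epigraph G \<Psi>"
    using memF by (auto simp: epigraph_def A'_def \<Psi>_def AB' G_def)
  then have "M \<inter> U = U \<inter> A' -` epigraph G \<Psi>" using M by simp
  then have "epi_lipschitzian_at_via G M x"
    unfolding epi_lipschitzian_at_via_def using G Gc U linA' homA' lip' by blast
  then show ?thesis unfolding epi_lipschitzian_at_def by blast
qed

definition clarke_dderiv :: "('a::real_normed_vector \<Rightarrow> real) \<Rightarrow> 'a \<Rightarrow> 'a \<Rightarrow> ereal" where
  "clarke_dderiv f x v =
     Limsup (nhds x \<times>\<^sub>F at_right 0) (\<lambda>(y, t). ereal ((f (y + t *\<^sub>R v) - f y) / t))"

definition clarke_gradient :: "('a::real_normed_vector \<Rightarrow> real) \<Rightarrow> 'a \<Rightarrow> ('a \<Rightarrow>\<^sub>L real) set" where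
  "clarke_gradient f x = {\<xi>. \<forall>v. clarke_dderiv f x v \<ge> ereal (blinfun_apply \<xi> v)}"

end

theory Submission
  imports Defs
begin

text \<open>
  From (i) to (ii), \<open>f\<close> is the signed distance \<open>d(x, M) - d(x, - M)\<close>. In a chart in which
  \<open>M\<close> is an epigraph, \<open>M\<close> is stable near \<open>x\<close> under translation by an open cone around
  the vertical direction \<open>v\<close>. Hence a ball contained in \<open>M\<close> grows at a linear rate when it is
  moved along \<open>v\<close>, and likewise a ball in the complement when it is moved along \<open>- v\<close>, so
  that \<open>f\<close> decreases along \<open>v\<close> at a rate that is uniform near \<open>x\<close>. Such uniform decrease
  in some direction is exactly \<open>0 \<notin> \<partial>f(x)\<close>.

  From (ii) to (i), let \<open>v\<close> be a direction of uniform decrease at a boundary point. A complement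
  of the line through \<open>v\<close> exists by Hahn--Banach, and over that complement \<open>f = 0\<close> defines
  implicitly a Lipschitz function whose epigraph is \<open>M\<close> near the point.
\<close>

section \<open>Sublinear functionals\<close>

text \<open>Homogeneity is required as an inequality only, which is less to check for infima;
  scaling back by \<open>1 / c\<close> recovers equality.\<close>

definition sublinear :: "('a::real_vector \<Rightarrow> real) \<Rightarrow> bool" where
  "sublinear p \<longleftrightarrow>
     (\<forall>x y. p (x + y) \<le> p x + p y) \<and> (\<forall>c>0. \<forall>x. p (c *\<^sub>R x) \<le> c * p x)"

lemma sublinear_add: "sublinear p \<Longrightarrow> p (x + y) \<le> p x + p y"
  by (simp add: sublinear_def)

lemma sublinear_scale_le: "sublinear p \<Longrightarrow> c > 0 \<Longrightarrow> p (c *\<^sub>R x) \<le> c * p x"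
  by (simp add: sublinear_def)

lemma sublinear_scale:
  assumes "sublinear p" "c > 0"
  shows "p (c *\<^sub>R x) = c * p x"
proof -
  have "p ((1 / c) *\<^sub>R (c *\<^sub>R x)) \<le> (1 / c) * p (c *\<^sub>R x)"
    using assms by (intro sublinear_scale_le) auto
  then have "c * p x \<le> p (c *\<^sub>R x)"
    using assms(2) by (simp add: field_simps)
  then show ?thesis using sublinear_scale_le[OF assms, of x] by simp
qed

lemma sublinear_zero:
  assumes "sublinear p" shows "p 0 = 0"
  using sublinear_scale[OF assms, of 2 0] by simp

lemma sublinear_uminus:
  assumes "sublinear p" shows "- p (- x) \<le> p x"
  using sublinear_add[OF assms, of x "- x"] sublinear_zero[OF assms] by simp

text \<open>\<open>q x\<close> is the infimum of \<open>p (x + t y) - t p y\<close> over \<open>t \<ge> 0\<close>. Consequently a minimal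
  sublinear functional is additive, and for the norm and \<open>x = - y\<close> the last inequality gives
  a value at most \<open>- norm y\<close>.\<close>

lemma sublinear_shrink:
  fixes p :: "'a::real_vector \<Rightarrow> real"
  assumes p: "sublinear p"
  obtains q where "sublinear q" "\<And>x. q x \<le> p x" "\<And>x. q x \<le> p (x + y) - p y"
proof -
  define g where "g = (\<lambda>x t. p (x + t *\<^sub>R y) - t * p y)"
  define q where "q = (\<lambda>x. INF t\<in>{0..}. g x t)"
  \<comment> \<open>A bound independent of \<open>t\<close> makes the infimum defining
    \<open>q\<close> finite; it comes from subadditivity at
    \<open>t *\<^sub>R y = (x + t *\<^sub>R y) + (- x)\<close>.\<close>
  have "- p (- x) \<le> g x t" if "t \<ge> 0" for x t
  proof -
    have "t * p y = p (t *\<^sub>R y)"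
      using that sublinear_scale[OF p, of t y] sublinear_zero[OF p] by (cases "t = 0") auto
    also have "\<dots> \<le> p (x + t *\<^sub>R y) + p (- x)"
      using sublinear_add[OF p, of "x + t *\<^sub>R y" "- x"] by simp
    finally show ?thesis by (simp add: g_def)
  qed
  then have bdd: "bdd_below (g x ` {0..})" for x
    by (intro bdd_belowI2[of _ "- p (- x)"]) auto
  have q_le: "q x \<le> g x t" if "t \<ge> 0" for x t
    unfolding q_def using that by (intro cINF_lower bdd) auto
  have le_q: "a \<le> q x" if "\<And>t. t \<ge> 0 \<Longrightarrow> a \<le> g x t" for a x
    unfolding q_def using that by (intro cINF_greatest) auto
  have add: "q (x + z) \<le> q x + q z" for x z
  proof -
    have "q (x + z) \<le> g x s + g z t" if "s \<ge> 0" "t \<ge> 0" for s t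
    proof -
      have "q (x + z) \<le> g (x + z) (s + t)" using that by (intro q_le) simp
      also have "\<dots> \<le> g x s + g z t"
        using sublinear_add[OF p, of "x + s *\<^sub>R y" "z + t *\<^sub>R y"]
        by (simp add: g_def algebra_simps)
      finally show ?thesis .
    qed
    then have "q (x + z) - g x s \<le> q z" if "s \<ge> 0" for s
      using that by (intro le_q) (simp add: algebra_simps)
    then have "q (x + z) - q z \<le> q x"
      by (intro le_q) (simp add: algebra_simps)
    then show ?thesis by simp
  qed
  have scale: "q (c *\<^sub>R x) \<le> c * q x" if c: "c > 0" for c x
  proof -
    have "q (c *\<^sub>R x) / c \<le> q x"
    proof (rule le_q)
      fix t :: real assume "t \<ge> 0"
      then have "q (c *\<^sub>R x) \<le> g (c *\<^sub>R x) (c * t)" using c by (intro q_le) simp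
      also have "\<dots> = c * g x t"
        using sublinear_scale[OF p c, of "x + t *\<^sub>R y"] by (simp add: g_def algebra_simps)
      finally show "q (c *\<^sub>R x) / c \<le> g x t" using c by (simp add: field_simps)
    qed
    then show ?thesis using c by (simp add: field_simps)
  qed
  show thesis
  proof (rule that[of q])
    show "sublinear q" using add scale by (simp add: sublinear_def)
    show "q x \<le> p x" for x using q_le[of 0 x] by (simp add: g_def)
    show "q x \<le> p (x + y) - p y" for x using q_le[of 1 x] by (simp add: g_def)
  qed
qed

text \<open>The pointwise infimum works: two members of a chain have a common lower member, so
  subadditivity passes to the infimum, and \<open>- p0 (- x)\<close> keeps it finite. This supplies
  the bounds of chains in Zorn's lemma.\<close>

lemma sublinear_chain_Inf:
  fixes C :: "('a::real_vector \<Rightarrow> real) set"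
  assumes "C \<noteq> {}" and sub: "\<And>p. p \<in> C \<Longrightarrow> sublinear p"
    and le: "\<And>p x. p \<in> C \<Longrightarrow> p x \<le> p0 x"
    and chain: "\<And>p q. p \<in> C \<Longrightarrow> q \<in> C \<Longrightarrow> p \<le> q \<or> q \<le> p"
  obtains u where "sublinear u" "\<And>p. p \<in> C \<Longrightarrow> u \<le> p"
proof -
  define u where "u = (\<lambda>x. INF p\<in>C. p x)"
  have bdd: "bdd_below ((\<lambda>p. p x) ` C)" for x
  proof (rule bdd_belowI2)
    fix p assume "p \<in> C"
    then show "- p0 (- x) \<le> p x"
      using sublinear_uminus[OF sub, of p x] le[of p "- x"] by simp
  qed
  have u_le: "u x \<le> p x" if "p \<in> C" for p x
    unfolding u_def using that by (intro cINF_lower bdd)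
  have le_u: "a \<le> u x" if "\<And>p. p \<in> C \<Longrightarrow> a \<le> p x" for a x
    unfolding u_def using that assms(1) by (intro cINF_greatest)
  have "u (x + y) \<le> u x + u y" for x y
  proof -
    have "u (x + y) \<le> q y + p x" if pq: "p \<in> C" "q \<in> C" for p q
    proof -
      obtain r where r: "r \<in> C" "r \<le> p" "r \<le> q" using chain[OF pq] pq by blast
      have "u (x + y) \<le> r (x + y)" using r by (intro u_le)
      also have "\<dots> \<le> r x + r y" using r sub sublinear_add by blast
      also have "\<dots> \<le> q y + p x"
        using r by (subst add.commute, intro add_mono) (auto simp: le_fun_def)
      finally show ?thesis .
    qed
    then have "u (x + y) - p x \<le> u y" if "p \<in> C" for p
      using that by (intro le_u) (simp add: diff_le_eq)
    then have "u (x + y) - u y \<le> u x"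
      by (intro le_u) (simp add: algebra_simps)
    then show ?thesis by simp
  qed
  moreover have "u (c *\<^sub>R x) \<le> c * u x" if c: "c > 0" for c x
  proof -
    have "u (c *\<^sub>R x) / c \<le> u x"
    proof (rule le_u)
      fix p assume p: "p \<in> C"
      then have "u (c *\<^sub>R x) \<le> c * p x"
        using u_le[OF p, of "c *\<^sub>R x"] sublinear_scale_le[OF sub c, of p x] by simp
      then show "u (c *\<^sub>R x) / c \<le> p x" using c by (simp add: field_simps)
    qed
    then show ?thesis using c by (simp add: field_simps)
  qed
  ultimately show thesis
    using that[of u] u_le by (simp add: sublinear_def le_fun_def)
qed

text \<open>The algebraic core of Hahn--Banach. Zorn's lemma for the reversed order yields a minimal
  sublinear functional below \<open>p\<close>, and minimality forces linearity.\<close>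

lemma linear_below_sublinear:
  fixes p :: "'a::real_vector \<Rightarrow> real"
  assumes p: "sublinear p"
  obtains g where "linear g" "\<And>x. g x \<le> p x"
proof -
  define S where "S = {q. sublinear q \<and> q \<le> p}"
  have "\<exists>m\<in>S. \<forall>q\<in>S. q \<le> m \<longrightarrow> q = m"
  proof (rule predicate_Zorn)
    show "partial_order_on S (relation_of (\<lambda>a b. b \<le> a) S)"
      by (rule partial_order_on_relation_ofI) auto
    fix C assume C: "C \<in> Chains (relation_of (\<lambda>a b. b \<le> a) S)"
    then have CS: "C \<subseteq> S" by (auto simp: Chains_def relation_of_def)
    show "\<exists>u\<in>S. \<forall>q\<in>C. u \<le> q"
    proof (cases "C = {}")
      case True
      then show ?thesis using p by (auto simp: S_def)
    next
      case False
      obtain u where u: "sublinear u" "\<And>q. q \<in> C \<Longrightarrow> u \<le> q"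
      proof (rule sublinear_chain_Inf[OF False, of p])
        show "sublinear q" if "q \<in> C" for q using that CS by (auto simp: S_def)
        show "q x \<le> p x" if "q \<in> C" for q x using that CS by (auto simp: S_def le_fun_def)
        show "q \<le> r \<or> r \<le> q" if "q \<in> C" "r \<in> C" for q r
          using C that by (auto simp: Chains_def relation_of_def)
      qed blast
      moreover have "u \<le> p"
      proof -
        obtain q where q: "q \<in> C" using False by blast
        then have "q \<le> p" using CS by (auto simp: S_def)
        then show ?thesis using u(2)[OF q] by (rule order_trans[rotated])
      qed
      ultimately show ?thesis by (auto simp: S_def)
    qed
  qed
  then obtain m where m: "sublinear m" "m \<le> p"
    and min: "\<And>q. sublinear q \<Longrightarrow> q \<le> m \<Longrightarrow> q = m"
    unfolding S_def by (auto intro: order_trans)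
  have add: "m (x + y) = m x + m y" for x y
  proof -
    \<comment> \<open>By minimality the shrunken functional is \<open>m\<close> itself, so its last
      inequality is superadditivity of \<open>m\<close>.\<close>
    obtain q where q: "sublinear q" "\<And>x. q x \<le> m x" "\<And>x. q x \<le> m (x + y) - m y"
      using sublinear_shrink[OF m(1), of y] by blast
    then have "q = m" by (intro min) (auto simp: le_fun_def)
    then show ?thesis using q(3)[of x] sublinear_add[OF m(1), of x y] by simp
  qed
  have neg: "m (- x) = - m x" for x
    using add[of x "- x"] sublinear_zero[OF m(1)] by simp
  have "m (c *\<^sub>R x) = c * m x" for c x
  proof (cases c "0 :: real" rule: linorder_cases)
    case less
    then show ?thesis using sublinear_scale[OF m(1), of "- c" x] by (simp add: neg)
  next
    case equal
    then show ?thesis using sublinear_zero[OF m(1)] by simp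
  next
    case greater
    then show ?thesis using sublinear_scale[OF m(1)] by simp
  qed
  then have "linear m" using add by (intro linearI) auto
  then show thesis using that m(2) by (auto simp: le_fun_def)
qed

text \<open>The norm is shrunk in the direction \<open>v\<close> before a linear functional is
  chosen below it. This forces a value at most \<open>- norm v\<close> at \<open>- v\<close>, so
  normalisation is possible, while domination by the norm gives boundedness.\<close>

lemma functional_eq_one:
  fixes v :: "'a::real_normed_vector"
  assumes "v \<noteq> 0"
  obtains g :: "'a \<Rightarrow> real" where "bounded_linear g" "g v = 1"
proof -
  have "sublinear (norm :: 'a \<Rightarrow> real)" by (simp add: sublinear_def norm_triangle_ineq)
  then obtain q :: "'a \<Rightarrow> real" where q: "sublinear q" "\<And>x. q x \<le> norm x"
    "\<And>x. q x \<le> norm (x + v) - norm v"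
    using sublinear_shrink[of norm v] by blast
  obtain h where h: "linear h" "\<And>x. h x \<le> q x" using linear_below_sublinear[OF q(1)] by blast
  have "h (- v) \<le> - norm v" using h(2)[of "- v"] q(3)[of "- v"] by simp
  then have hv: "h v > 0" using assms by (simp add: linear_neg[OF h(1)])
      (metis less_le_trans zero_less_norm_iff)
  have "\<bar>h x\<bar> \<le> norm x * 1" for x
    using h(2)[of x] q(2)[of x] h(2)[of "- x"] q(2)[of "- x"] by (simp add: linear_neg[OF h(1)])
  then have "bounded_linear h"
    using h(1) by (intro bounded_linear_intro[where K = 1]) (auto simp: linear_add linear_cmul)
  then have "bounded_linear (\<lambda>x. h x / h v)" by (rule bounded_linear_divide[THEN bounded_linear_compose])
  then show thesis using hv by (intro that[of "\<lambda>x. h x / h v"]) auto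
qed

section \<open>Descent directions and level sets\<close>

text \<open>Zero is excluded exactly when the generalized derivative is negative in some direction;
  a negative limsup means that the difference quotients eventually stay below some
  \<open>- c\<close>.\<close>

lemma zero_notin_clarke_gradient_iff:
  fixes f :: "'a::real_normed_vector \<Rightarrow> real"
  shows "0 \<notin> clarke_gradient f x \<longleftrightarrow>
    (\<exists>v. \<exists>c>0. \<exists>r>0. \<forall>y\<in>ball x r. \<forall>t. 0 < t \<and> t < r \<longrightarrow> f (y + t *\<^sub>R v) \<le> f y - c * t)"
    (is "_ \<longleftrightarrow> (\<exists>v. \<exists>c>0. ?D v c)")
proof -
  have D: "?D v c \<longleftrightarrow> (\<forall>\<^sub>F (y, t) in nhds x \<times>\<^sub>F at_right 0. (f (y + t *\<^sub>R v) - f y) / t \<le> - c)"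
    (is "_ \<longleftrightarrow> ?E v c") for v c
  proof
    assume "?D v c"
    then obtain r where r: "r > 0"
      "\<And>y t. y \<in> ball x r \<Longrightarrow> 0 < t \<Longrightarrow> t < r \<Longrightarrow> f (y + t *\<^sub>R v) \<le> f y - c * t" by blast
    have "\<forall>\<^sub>F y in nhds x. y \<in> ball x r" using r(1) by (intro eventually_nhds_in_open) auto
    moreover have "\<forall>\<^sub>F t in at_right 0. 0 < t \<and> t < r"
      using r(1) by (auto simp: eventually_at_right_field)
    ultimately show "?E v c"
      unfolding eventually_prod_filter using r(2)
      by (intro exI[of _ "\<lambda>y. y \<in> ball x r"] exI[of _ "\<lambda>t. 0 < t \<and> t < r"])
        (auto simp: field_simps)
  next
    assume "?E v c"
    then obtain P Q where P: "\<forall>\<^sub>F y in nhds x. P y" and Q: "\<forall>\<^sub>F t in at_right 0. Q t"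
      and PQ: "\<And>y t. P y \<Longrightarrow> Q t \<Longrightarrow> (f (y + t *\<^sub>R v) - f y) / t \<le> - c"
      unfolding eventually_prod_filter by auto
    obtain a where a: "a > 0" "\<And>y. dist y x < a \<Longrightarrow> P y"
      using P unfolding eventually_nhds_metric by blast
    obtain b :: real where b: "b > 0" "\<And>t. 0 < t \<Longrightarrow> t < b \<Longrightarrow> Q t"
      using Q by (auto simp: eventually_at_right_field)
    have "f (y + t *\<^sub>R v) \<le> f y - c * t" if "y \<in> ball x (min a b)" "0 < t" "t < min a b" for y t
      using PQ[of y t] a(2)[of y] b(2)[of t] that by (auto simp: field_simps dist_commute)
    then show "?D v c" using a(1) b(1) by (intro exI[of _ "min a b"]) auto
  qed
  have "0 \<notin> clarke_gradient f x \<longleftrightarrow> (\<exists>v. clarke_dderiv f x v < 0)"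
    by (simp add: clarke_gradient_def not_le zero_ereal_def)
  also have "\<dots> \<longleftrightarrow> (\<exists>v. \<exists>c>0. ?E v c)"
  proof (intro ex_cong1 iffI)
    fix v assume "clarke_dderiv f x v < 0"
    \<comment> \<open>The limsup may be minus infinity a priori, so the rate is taken from a real
      number strictly between it and 0.\<close>
    then obtain a where a: "clarke_dderiv f x v < ereal a" "ereal a < 0"
      using ereal_dense2 by blast
    then have "\<forall>\<^sub>F z in nhds x \<times>\<^sub>F at_right 0.
        (case z of (y, t) \<Rightarrow> ereal ((f (y + t *\<^sub>R v) - f y) / t)) < ereal a"
      unfolding clarke_dderiv_def by (intro Limsup_lessD) auto
    then have "?E v (- a)" by (rule eventually_mono) auto
    then show "\<exists>c>0. ?E v c" using a(2) by (intro exI[of _ "- a"]) auto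
  next
    fix v assume "\<exists>c>0. ?E v c"
    then obtain c where c: "c > 0" "?E v c" by blast
    have "clarke_dderiv f x v \<le> ereal (- c)"
      unfolding clarke_dderiv_def
      by (rule Limsup_bounded) (use c(2) in \<open>auto elim!: eventually_mono\<close>)
    also have "\<dots> < 0" using c(1) by simp
    finally show "clarke_dderiv f x v < 0" .
  qed
  finally show ?thesis by (simp only: D)
qed

text \<open>A functional with \<open>g v = 1\<close> splits the space as the kernel of
  \<open>g\<close> times the line through \<open>v\<close>. The chart sends \<open>y\<close> to
  \<open>(y - g y *\<^sub>R v, g y)\<close>, with inverse \<open>(\<eta>, t)\<close> to
  \<open>\<eta> + t *\<^sub>R v\<close>.\<close>

lemma epi_lipschitzian_at_split:
  fixes v x :: "'a::banach" and g :: "'a \<Rightarrow> real"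
  assumes g: "bounded_linear g" "g v = 1" and U: "open U" "x \<in> U"
    and lip: "lipschitz_around {y. g y = 0} \<Phi> (x - g x *\<^sub>R v)"
    and M: "\<And>y. y \<in> U \<Longrightarrow> y \<in> M \<longleftrightarrow> \<Phi> (y - g y *\<^sub>R v) \<le> g y"
  shows "epi_lipschitzian_at M x"
proof -
  interpret g: bounded_linear g by fact
  define F where "F = {y. g y = 0}"
  define A where "A = (\<lambda>y. (y - g y *\<^sub>R v, g y))"
  define B where "B = (\<lambda>(y, t). y + t *\<^sub>R v)"
  have cont: "continuous_on S g" for S by (rule g.continuous_on) simp
  have F: "subspace F" by (auto simp: subspace_def F_def g.zero g.add g.scaleR)
  have "closed F"
    unfolding F_def by (intro closed_Collect_eq continuous_intros cont)
  then have Fc: "complete F" by (simp add: complete_eq_closed)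
  have linA: "linear A"
    by (rule linearI) (auto simp: A_def g.add g.scaleR algebra_simps)
  have hom: "homeomorphism UNIV (F \<times> UNIV) A B"
  proof (rule homeomorphismI)
    show "continuous_on UNIV A" unfolding A_def by (intro continuous_intros cont)
    show "continuous_on (F \<times> UNIV) B"
      unfolding B_def case_prod_beta by (intro continuous_intros)
    show "A ` UNIV \<subseteq> F \<times> UNIV" by (auto simp: A_def F_def g.diff g.scaleR g(2))
    show "B (A y) = y" for y by (simp add: A_def B_def)
    show "A (B p) = p" if "p \<in> F \<times> UNIV" for p
      using that by (auto simp: A_def B_def F_def g.add g.scaleR g(2))
  qed simp
  have "M \<inter> U = U \<inter> A -` epigraph F \<Phi>"
    using M by (auto simp: epigraph_def A_def F_def g.diff g.scaleR g(2))
  then have "epi_lipschitzian_at_via F M x"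
    unfolding epi_lipschitzian_at_via_def
    using F Fc U linA hom lip interior_open[OF U(1)]
    by (intro conjI exI[of _ U] exI[of _ A] exI[of _ B] exI[of _ \<Phi>]) (auto simp: A_def F_def)
  then show ?thesis unfolding epi_lipschitzian_at_def by blast
qed

text \<open>Near an interior point the set is everything, so a constant strictly below the height
  \<open>g x\<close> serves as \<open>\<Phi>\<close>; the vector \<open>v\<close> only provides a
  splitting.\<close>

lemma epi_lipschitzian_at_interior:
  fixes v x :: "'a::banach"
  assumes "v \<noteq> 0" "x \<in> interior M"
  shows "epi_lipschitzian_at M x"
proof -
  obtain g :: "'a \<Rightarrow> real" where g: "bounded_linear g" "g v = 1"
    using functional_eq_one[OF assms(1)] by blast
  have cont: "continuous_on S g" for S
    using g(1) by (rule bounded_linear.continuous_on) simp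
  show ?thesis
  proof (rule epi_lipschitzian_at_split[OF g, where \<Phi> = "\<lambda>_. g x - 1"])
    show "open (interior M \<inter> {y. g x - 1 < g y})"
      by (intro open_Int open_Collect_less continuous_intros cont) simp
    show "lipschitz_around {y. g y = 0} (\<lambda>_. g x - 1) (x - g x *\<^sub>R v)"
      unfolding lipschitz_around_def
      by (intro exI[of _ 1] conjI exI[of _ 0] lipschitz_onI) auto
    show "y \<in> M \<longleftrightarrow> g x - 1 \<le> g y" if "y \<in> interior M \<inter> {y. g x - 1 < g y}" for y
      using that interior_subset by auto
  qed (use assms(2) in auto)
qed

text \<open>The boundary is the graph of the function \<open>\<Phi>\<close> implicitly defined by
  \<open>f (\<eta> + \<Phi> \<eta> v) = 0\<close> along the descent direction \<open>v\<close>; the descent rate \<open>c\<close>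
  and the Lipschitz constant \<open>L\<close> of \<open>f\<close> give the Lipschitz constant \<open>L / c\<close> of \<open>\<Phi>\<close>.\<close>

lemma epi_lipschitzian_at_level_set:
  fixes f :: "'a::banach \<Rightarrow> real"
  assumes lip: "lipschitz_around UNIV f x" and fx: "f x = 0" and grad: "0 \<notin> clarke_gradient f x"
  shows "epi_lipschitzian_at {y. f y \<le> 0} x"
proof -
  obtain v c r where c: "c > 0" and r: "r > 0"
    and desc0: "\<And>y t. y \<in> ball x r \<Longrightarrow> 0 < t \<Longrightarrow> t < r \<Longrightarrow> f (y + t *\<^sub>R v) \<le> f y - c * t"
    using grad unfolding zero_notin_clarke_gradient_iff by blast
  obtain e L where e: "e > 0" and L: "L-lipschitz_on (ball x e) f"
    using lip unfolding lipschitz_around_def by auto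
  have L0: "L \<ge> 0" using L by (rule lipschitz_on_nonneg)
  define \<delta> where "\<delta> = min r e"
  have \<delta>: "\<delta> > 0" using r e by (simp add: \<delta>_def)
  have desc: "f (y + t *\<^sub>R v) \<le> f y - c * t" if "y \<in> ball x \<delta>" "0 < t" "t < \<delta>" for y t
    using desc0 that by (auto simp: \<delta>_def)
  have lipf: "\<bar>f y - f z\<bar> \<le> L * norm (y - z)" if "y \<in> ball x \<delta>" "z \<in> ball x \<delta>" for y z
    using lipschitz_onD[OF L, of y z] that by (auto simp: \<delta>_def dist_norm)
  have "v \<noteq> 0"
    using desc[of x "\<delta> / 2"] \<delta> mult_pos_pos[OF c \<delta>] by auto
  then obtain g :: "'a \<Rightarrow> real" where g: "bounded_linear g" "g v = 1"
    using functional_eq_one by blast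
  have contg: "continuous_on S g" for S
    using g(1) by (rule bounded_linear.continuous_on) simp
  define t0 where "t0 = g x"
  define \<eta>0 where "\<eta>0 = x - t0 *\<^sub>R v"
  \<comment> \<open>Half the height of the box around \<open>x\<close>. It satisfies
    \<open>s * norm v + 2 * s = \<delta> / 2\<close>, so the box stays in
    \<open>ball x \<delta>\<close> and every vertical step in it is short enough for the descent
    estimate.\<close>
  define s where "s = \<delta> / (2 * (norm v + 2))"
  have s: "s > 0" "2 * s < \<delta>" "s * norm v < \<delta> / 2"
  proof -
    have n: "norm v + 2 > 0" by (simp add: add_nonneg_pos)
    show "s > 0" using \<delta> n by (simp add: s_def)
    have "s * m = \<delta> / 2" if "m > 0" "s = \<delta> / (2 * m)" for m
      using that by simp
    then have "s * (norm v + 2) = \<delta> / 2" using n by (simp only: s_def)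
    then have eq: "s * norm v + 2 * s = \<delta> / 2" by (simp add: algebra_simps)
    have "0 \<le> s * norm v" using \<open>s > 0\<close> by simp
    then show "2 * s < \<delta>" "s * norm v < \<delta> / 2" using eq \<open>s > 0\<close> \<delta> by linarith+
  qed
  \<comment> \<open>A horizontal move by less than \<open>d\<close> changes \<open>f\<close> by at
    most \<open>L * d \<le> c * s\<close>, the guaranteed drop over height \<open>s\<close>. The
    denominator \<open>L + 1\<close> covers \<open>L = 0\<close>.\<close>
  define d where "d = min (\<delta> / 2) (c * s / (L + 1))"
  have d: "d > 0" "d \<le> \<delta> / 2"
    using \<delta> c s(1) L0 unfolding d_def by (simp, intro min.cobounded1)
  have "L * d \<le> L * (c * s / (L + 1))" using L0 by (intro mult_left_mono) (auto simp: d_def)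
  also have "\<dots> \<le> c * s" using L0 c s by (simp add: field_simps)
  finally have Ld: "L * d \<le> c * s" .
  have in_ball: "\<eta> + t *\<^sub>R v \<in> ball x \<delta>"
    if "\<eta> \<in> ball \<eta>0 d" "t \<in> {t0 - s..t0 + s}" for \<eta> t
  proof -
    have "norm (\<eta> + t *\<^sub>R v - x) = norm ((\<eta> - \<eta>0) + (t - t0) *\<^sub>R v)"
      by (simp add: \<eta>0_def algebra_simps)
    also have "\<dots> \<le> norm (\<eta> - \<eta>0) + \<bar>t - t0\<bar> * norm v"
      using norm_triangle_ineq[of "\<eta> - \<eta>0" "(t - t0) *\<^sub>R v"] by simp
    also have "\<dots> \<le> norm (\<eta> - \<eta>0) + s * norm v"
      using that(2) by (intro add_left_mono mult_right_mono) auto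
    also have "\<dots> < \<delta>" using that(1) d(2) s(3) by (simp add: dist_norm norm_minus_commute)
    finally show ?thesis by (simp add: dist_norm norm_minus_commute)
  qed
  have mono: "f (\<eta> + b *\<^sub>R v) \<le> f (\<eta> + a *\<^sub>R v) - c * (b - a)"
    if "\<eta> \<in> ball \<eta>0 d" "a \<in> {t0 - s..t0 + s}" "b \<in> {t0 - s..t0 + s}" "a < b" for \<eta> a b
    using desc[OF in_ball[OF that(1,2)], of "b - a"] that s(2) by (simp add: algebra_simps)
  have x: "x = \<eta>0 + t0 *\<^sub>R v" by (simp add: \<eta>0_def)
  have "\<exists>t\<in>{t0 - s..t0 + s}. f (\<eta> + t *\<^sub>R v) = 0" if \<eta>: "\<eta> \<in> ball \<eta>0 d" for \<eta>
  proof -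
    have \<eta>0: "\<eta>0 \<in> ball \<eta>0 d" using d by simp
    have close: "\<bar>f (\<eta> + t *\<^sub>R v) - f (\<eta>0 + t *\<^sub>R v)\<bar> \<le> c * s" if "t \<in> {t0 - s..t0 + s}" for t
    proof -
      have "\<bar>f (\<eta> + t *\<^sub>R v) - f (\<eta>0 + t *\<^sub>R v)\<bar> \<le> L * norm (\<eta> - \<eta>0)"
        using lipf[OF in_ball[OF \<eta> that] in_ball[OF \<eta>0 that]] by simp
      also have "\<dots> \<le> L * d"
        using \<eta> L0 by (intro mult_left_mono) (auto simp: dist_norm norm_minus_commute)
      finally show ?thesis using Ld by simp
    qed
    \<comment> \<open>On the line over \<open>\<eta>0\<close>, \<open>f\<close> is at least
      \<open>c * s\<close> at the bottom and at most \<open>- c * s\<close> at the top. The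
      horizontal shift to \<open>\<eta>\<close> costs at most \<open>c * s\<close>, so the signs
      survive.\<close>
    have "\<exists>t\<ge>t0 - s. t \<le> t0 + s \<and> f (\<eta> + t *\<^sub>R v) = 0"
    proof (rule IVT2')
      show "f (\<eta> + (t0 + s) *\<^sub>R v) \<le> 0"
        using mono[OF \<eta>0, of t0 "t0 + s"] close[of "t0 + s"] s(1) fx x by auto
      show "0 \<le> f (\<eta> + (t0 - s) *\<^sub>R v)"
        using mono[OF \<eta>0, of "t0 - s" t0] close[of "t0 - s"] s(1) fx x by auto
      have "continuous_on (ball x e) f" using L by (rule lipschitz_on_continuous_on)
      then show "continuous_on {t0 - s..t0 + s} (\<lambda>t. f (\<eta> + t *\<^sub>R v))"
        by (rule continuous_on_compose2)
          (use in_ball[OF \<eta>] in \<open>auto intro!: continuous_intros simp: \<delta>_def\<close>)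
    qed (use s in simp)
    then show ?thesis by auto
  qed
  then obtain \<Phi> where \<Phi>: "\<And>\<eta>. \<eta> \<in> ball \<eta>0 d \<Longrightarrow> \<Phi> \<eta> \<in> {t0 - s..t0 + s}"
    "\<And>\<eta>. \<eta> \<in> ball \<eta>0 d \<Longrightarrow> f (\<eta> + \<Phi> \<eta> *\<^sub>R v) = 0"
    by metis
  have \<Phi>_le: "\<Phi> \<eta>' - \<Phi> \<eta> \<le> L / c * norm (\<eta> - \<eta>')"
    if \<eta>: "\<eta> \<in> ball \<eta>0 d" and \<eta>': "\<eta>' \<in> ball \<eta>0 d" for \<eta> \<eta>'
  proof (cases "\<Phi> \<eta> < \<Phi> \<eta>'")
    case True
    \<comment> \<open>Both estimates concern \<open>f\<close> over \<open>\<eta>'\<close> at height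
      \<open>\<Phi> \<eta>\<close>: descent up to the zero at \<open>\<Phi> \<eta>'\<close> bounds
      it below, comparison with the zero over \<open>\<eta>\<close> bounds it above.\<close>
    have "c * (\<Phi> \<eta>' - \<Phi> \<eta>) \<le> f (\<eta>' + \<Phi> \<eta> *\<^sub>R v)"
      using mono[OF \<eta>' \<Phi>(1)[OF \<eta>] \<Phi>(1)[OF \<eta>'] True] \<Phi>(2)[OF \<eta>'] by simp
    also have "\<dots> \<le> L * norm (\<eta> - \<eta>')"
      using lipf[OF in_ball[OF \<eta>' \<Phi>(1)[OF \<eta>]] in_ball[OF \<eta> \<Phi>(1)[OF \<eta>]]] \<Phi>(2)[OF \<eta>]
      by (simp add: norm_minus_commute)
    finally show ?thesis using c by (simp add: field_simps)
  next
    case False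
    moreover have "0 \<le> L / c * norm (\<eta> - \<eta>')" using L0 c by simp
    ultimately show ?thesis by linarith
  qed
  define U where "U = {y. dist \<eta>0 (y - g y *\<^sub>R v) < d} \<inter> {y. \<bar>g y - t0\<bar> < s}"
  show ?thesis
  proof (rule epi_lipschitzian_at_split[OF g, where U = U and \<Phi> = \<Phi>])
    show "open U" unfolding U_def
      by (intro open_Int open_Collect_less continuous_intros contg)
    show "x \<in> U" using d s by (simp add: U_def \<eta>0_def t0_def)
    have "(L / c)-lipschitz_on (ball \<eta>0 d \<inter> {y. g y = 0}) \<Phi>"
    proof (rule lipschitz_onI)
      fix y z assume "y \<in> ball \<eta>0 d \<inter> {y. g y = 0}" "z \<in> ball \<eta>0 d \<inter> {y. g y = 0}"
      then show "dist (\<Phi> y) (\<Phi> z) \<le> L / c * dist y z"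
        using \<Phi>_le[of y z] \<Phi>_le[of z y] by (auto simp: dist_norm norm_minus_commute)
    qed (use L0 c in auto)
    then show "lipschitz_around {y. g y = 0} \<Phi> (x - g x *\<^sub>R v)"
      unfolding lipschitz_around_def using d(1) by (auto simp: \<eta>0_def t0_def)
    fix y assume y: "y \<in> U"
    define \<eta> where "\<eta> = y - g y *\<^sub>R v"
    have \<eta>: "\<eta> \<in> ball \<eta>0 d" and t: "g y \<in> {t0 - s..t0 + s}" and yeq: "y = \<eta> + g y *\<^sub>R v"
      using y by (auto simp: U_def \<eta>_def)
    \<comment> \<open>Strict decrease along \<open>v\<close> makes the sign of \<open>f\<close>
      depend only on the position relative to the zero at height
      \<open>\<Phi> \<eta>\<close>.\<close>
    have "f y \<le> 0 \<longleftrightarrow> \<Phi> \<eta> \<le> g y"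
    proof (cases "\<Phi> \<eta>" "g y" rule: linorder_cases)
      case less
      have "c * (g y - \<Phi> \<eta>) > 0" using less c by simp
      then show ?thesis using mono[OF \<eta> \<Phi>(1)[OF \<eta>] t less] \<Phi>(2)[OF \<eta>] yeq less by simp
    next
      case equal
      then show ?thesis using \<Phi>(2)[OF \<eta>] yeq by simp
    next
      case greater
      have "c * (\<Phi> \<eta> - g y) > 0" using greater c by simp
      then show ?thesis using mono[OF \<eta> t \<Phi>(1)[OF \<eta>] greater] \<Phi>(2)[OF \<eta>] yeq greater by simp
    qed
    then show "y \<in> {y. f y \<le> 0} \<longleftrightarrow> \<Phi> (y - g y *\<^sub>R v) \<le> g y" by (simp add: \<eta>_def)
  qed
qed

section \<open>The signed distance\<close>

text \<open>The vectors within \<open>t * \<epsilon>\<close> of \<open>t v\<close>, \<open>t \<ge> 0\<close>, form a cone; \<open>N\<close> is stable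
  under translation by it inside \<open>ball x r\<close>.\<close>

definition cone_closed_near ::
    "'a::real_normed_vector \<Rightarrow> real \<Rightarrow> 'a \<Rightarrow> real \<Rightarrow> 'a set \<Rightarrow> bool" where
  "cone_closed_near x r v \<epsilon> N \<longleftrightarrow>
     (\<forall>z\<in>N \<inter> ball x r. \<forall>w\<in>ball x r. \<forall>t\<ge>0. norm (w - z - t *\<^sub>R v) \<le> t * \<epsilon> \<longrightarrow> w \<in> N)"

lemma cone_closed_nearD:
  "cone_closed_near x r v \<epsilon> N \<Longrightarrow> z \<in> N \<Longrightarrow> z \<in> ball x r \<Longrightarrow> w \<in> ball x r \<Longrightarrow> t \<ge> 0 \<Longrightarrow>
    norm (w - z - t *\<^sub>R v) \<le> t * \<epsilon> \<Longrightarrow> w \<in> N"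
  by (auto simp: cone_closed_near_def)

text \<open>If a backward displacement led from the complement into \<open>N\<close>, the opposite
  forward displacement would carry that point of \<open>N\<close> back out of
  \<open>N\<close>.\<close>

lemma cone_closed_near_Compl:
  assumes "cone_closed_near x r v \<epsilon> N"
  shows "cone_closed_near x r (- v) \<epsilon> (- N)"
proof -
  have "w \<notin> N" if "z \<notin> N" "z \<in> ball x r" "w \<in> ball x r" "t \<ge> 0"
    "norm (w - z - t *\<^sub>R (- v)) \<le> t * \<epsilon>" for z w t
  proof
    assume w: "w \<in> N"
    have "z - w - t *\<^sub>R v = - (w - z - t *\<^sub>R (- v))" by (simp add: algebra_simps)
    then have "norm (z - w - t *\<^sub>R v) \<le> t * \<epsilon>" using that(5) by (metis norm_minus_cancel)
    then show False using cone_closed_nearD[OF assms w that(3,2,4)] that(1) by blast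
  qed
  then show ?thesis by (auto simp: cone_closed_near_def)
qed

lemma bounded_linear_if_continuous:
  fixes A :: "'a::real_normed_vector \<Rightarrow> 'b::real_normed_vector"
  assumes A: "linear A" and cont: "isCont A 0"
  shows "bounded_linear A"
proof -
  obtain d where d: "d > 0" "\<And>y. norm y < d \<Longrightarrow> norm (A y) < 1"
    using cont linear_0[OF A] by (auto simp: continuous_at_eps_delta dist_norm dest: spec[of _ 1])
  have "norm (A y) \<le> norm y * (2 / d)" for y
  proof (cases "y = 0")
    case True
    then show ?thesis using linear_0[OF A] by simp
  next
    case False
    define c where "c = d / (2 * norm y)"
    have c: "c > 0" using False d by (simp add: c_def)
    have "norm (c *\<^sub>R y) < d" using False d by (simp add: c_def)
    from d(2)[OF this] have "c * norm (A y) < 1"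
      using c by (simp add: linear_cmul[OF A])
    then show ?thesis using c False d by (simp add: c_def field_simps)
  qed
  then show ?thesis
    using A by (intro bounded_linear_intro[where K = "2 / d"]) (simp_all add: linear_add linear_cmul)
qed

text \<open>With \<open>v\<close> the preimage of \<open>(0, 1)\<close>, a displacement
  \<open>t *\<^sub>R v + u\<close> raises the height by nearly \<open>t\<close>, while
  \<open>\<Phi>\<close> grows only in proportion to \<open>norm u\<close>. For a narrow cone the
  epigraph is not left.\<close>

lemma epi_lipschitzian_at_cone:
  fixes M :: "'a::banach set"
  assumes "epi_lipschitzian_at M x"
  obtains r v \<epsilon> where "r > 0" "\<epsilon> > 0" "cone_closed_near x r v \<epsilon> M"
proof -
  obtain F :: "'a set" and U and A :: "'a \<Rightarrow> 'a \<times> real" and B \<Phi> where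
    F: "subspace F" and U: "x \<in> interior U" and A: "linear A"
    and hom: "homeomorphism UNIV (F \<times> UNIV) A B"
    and lip: "lipschitz_around F \<Phi> (fst (A x))"
    and M: "M \<inter> U = U \<inter> A -` epigraph F \<Phi>"
    using assms unfolding epi_lipschitzian_at_def epi_lipschitzian_at_via_def by blast
  have "continuous_on UNIV A" and AB: "\<And>p. p \<in> F \<times> UNIV \<Longrightarrow> A (B p) = p"
    and rangeA: "\<And>y. A y \<in> F \<times> UNIV"
    using hom unfolding homeomorphism_def by auto
  then have "isCont A 0" by (simp add: continuous_on_eq_continuous_at)
  then have "bounded_linear A" by (rule bounded_linear_if_continuous[OF A])
  then obtain K where K: "K > 0" "\<And>y. norm (A y) \<le> norm y * K"
    using bounded_linear.pos_bounded by blast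
  have memF: "fst (A y) \<in> F" for y using rangeA[of y] by auto
  have fst_le: "norm (fst (A y)) \<le> norm y * K" for y
    using norm_fst_le[of "fst (A y)" "snd (A y)"] K(2)[of y] by simp
  have snd_le: "\<bar>snd (A y)\<bar> \<le> norm y * K" for y
    using norm_snd_le[of "snd (A y)" "fst (A y)"] K(2)[of y] by simp
  obtain e L where e: "e > 0" and L: "L-lipschitz_on (ball (fst (A x)) e \<inter> F) \<Phi>"
    using lip unfolding lipschitz_around_def by blast
  have L0: "L \<ge> 0" using L by (rule lipschitz_on_nonneg)
  obtain r0 where r0: "r0 > 0" "ball x r0 \<subseteq> U"
    using U unfolding mem_interior by blast
  define r where "r = min r0 (e / K)"
  define v where "v = B (0, 1)"
  have Av: "A v = (0, 1)" unfolding v_def using F by (intro AB) (auto simp: subspace_0)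
  \<comment> \<open>Chosen so that \<open>(L + 1) * (t * \<epsilon> * K) = t\<close>: the error in
    height plus the growth of \<open>\<Phi>\<close> just uses up the gain \<open>t\<close>.\<close>
  define \<epsilon> where "\<epsilon> = 1 / ((L + 1) * K)"
  have \<epsilon>: "\<epsilon> > 0" using L0 K(1) by (simp add: \<epsilon>_def)
  have ball: "fst (A y) \<in> ball (fst (A x)) e \<inter> F" if "y \<in> ball x r" for y
  proof -
    have "norm (fst (A x) - fst (A y)) \<le> norm (x - y) * K"
      using fst_le[of "x - y"] by (simp add: linear_diff[OF A])
    also have "\<dots> < e" using that K(1) by (simp add: r_def dist_norm field_simps)
    finally show ?thesis using memF by (simp add: dist_norm)
  qed
  have M_iff: "y \<in> M \<longleftrightarrow> \<Phi> (fst (A y)) \<le> snd (A y)" if "y \<in> ball x r" for y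
  proof -
    have "y \<in> U" using that r0 by (auto simp: r_def)
    then show ?thesis using M memF[of y] by (auto simp: epigraph_def)
  qed
  have "w \<in> M" if z: "z \<in> M" "z \<in> ball x r" and w: "w \<in> ball x r" and t: "t \<ge> 0"
    and b: "norm (w - z - t *\<^sub>R v) \<le> t * \<epsilon>" for z w t
  proof -
    define u where "u = w - z - t *\<^sub>R v"
    have Aw: "A w = A z + t *\<^sub>R (0, 1) + A u"
      by (simp add: u_def linear_diff[OF A] linear_cmul[OF A] Av)
    have uK: "norm u * K \<le> t * \<epsilon> * K" using b K(1) by (simp add: u_def)
    have "\<Phi> (fst (A w)) - \<Phi> (fst (A z)) \<le> dist (\<Phi> (fst (A w))) (\<Phi> (fst (A z)))"
      by (simp add: dist_real_def)
    also have "\<dots> \<le> L * dist (fst (A w)) (fst (A z))"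
      using lipschitz_onD[OF L ball[OF w] ball[OF z(2)]] .
    also have "\<dots> = L * norm (fst (A u))" by (simp add: Aw dist_norm)
    also have "\<dots> \<le> L * (t * \<epsilon> * K)" using fst_le[of u] uK L0 by (intro mult_left_mono) auto
    finally have 1: "\<Phi> (fst (A w)) \<le> \<Phi> (fst (A z)) + L * (t * \<epsilon> * K)" by simp
    have 2: "snd (A w) \<ge> snd (A z) + t - t * \<epsilon> * K"
      using snd_le[of u] uK by (simp add: Aw)
    have "(L + 1) * (t * \<epsilon> * K) = t" using L0 K(1) by (simp add: \<epsilon>_def)
    then have "L * (t * \<epsilon> * K) = t - t * \<epsilon> * K" by (simp add: algebra_simps)
    then have "\<Phi> (fst (A w)) \<le> snd (A w)" using 1 2 M_iff[OF z(2)] z(1) by linarith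
    then show "w \<in> M" using M_iff[OF w] by simp
  qed
  then have "cone_closed_near x r v \<epsilon> M" by (auto simp: cone_closed_near_def)
  moreover have "r > 0" using r0 e K by (simp add: r_def)
  ultimately show thesis using that \<epsilon> by blast
qed

text \<open>A ball of radius \<open>\<rho>\<close> around \<open>y\<close> in \<open>N\<close> plus the slice of the cone at height \<open>t\<close>
  is the ball of radius \<open>\<rho> + t * \<epsilon>\<close> around \<open>y + t v\<close>. Since \<open>x\<close> is adherent to the
  complement, the balls involved stay inside \<open>ball x r\<close>.\<close>

lemma infdist_Compl_cone:
  fixes x :: "'a::real_normed_vector"
  assumes cone: "cone_closed_near x r v \<epsilon> N" and \<epsilon>: "\<epsilon> > 0" and x: "x \<in> closure (- N)"
    and y: "y \<in> N" "y \<in> ball x (r / 4)" and t: "t \<ge> 0" "t * (norm v + \<epsilon>) \<le> r / 4"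
  shows "infdist y (- N) + t * \<epsilon> \<le> infdist (y + t *\<^sub>R v) (- N)"
proof -
  define \<rho> where "\<rho> = infdist y (- N)"
  have ne: "- N \<noteq> {}" using x by auto
  have \<rho>: "0 \<le> \<rho>" "\<rho> < r / 4"
  proof -
    show "0 \<le> \<rho>" by (simp add: \<rho>_def infdist_nonneg)
    have "infdist x (- N) = 0" using x ne by (simp add: in_closure_iff_infdist_zero)
    then have "\<rho> \<le> dist y x" using infdist_triangle[of y "- N" x] by (simp add: \<rho>_def)
    then show "\<rho> < r / 4" using y(2) by (simp add: dist_commute)
  qed
  have "\<rho> + t * \<epsilon> \<le> dist (y + t *\<^sub>R v) p" if p: "p \<in> - N" for p
  proof (rule ccontr)
    define R where "R = \<rho> + t * \<epsilon>"
    define u where "u = p - (y + t *\<^sub>R v)"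
    assume "\<not> ?thesis"
    then have u: "norm u < R" by (simp add: u_def R_def dist_norm norm_minus_commute)
    have R: "R > 0" using u norm_ge_zero[of u] by linarith
    \<comment> \<open>The displacement \<open>u\<close> is divided in the ratio of
      \<open>\<rho>\<close> to \<open>t * \<epsilon>\<close>: the first part leads from
      \<open>y\<close> to \<open>z\<close>, the rest is absorbed by the cone slice from
      \<open>z\<close> to \<open>p\<close>.\<close>
    define z where "z = y + (\<rho> / R) *\<^sub>R u"
    have yz: "dist y z = \<rho> / R * norm u" using \<rho> R by (simp add: z_def dist_norm)
    have yz_le: "dist y z \<le> \<rho>" using R mult_left_mono[of "norm u" R \<rho>] u \<rho>(1) unfolding yz by (simp add: field_simps)
    \<comment> \<open>As \<open>norm u < R\<close>, the point \<open>z\<close> is strictly closer to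
      \<open>y\<close> than \<open>\<rho>\<close>, unless \<open>\<rho> = 0\<close>; in that case
      \<open>z = y\<close>.\<close>
    have "z \<in> N"
    proof (rule ccontr)
      assume "z \<notin> N"
      then have "\<rho> \<le> dist y z" unfolding \<rho>_def by (intro infdist_le) simp
      then have "\<rho> * R \<le> \<rho> * norm u" using R by (simp add: yz field_simps)
      then have "\<rho> = 0" using \<rho> u by (simp add: mult_le_cancel_left)
      then show False using \<open>z \<notin> N\<close> y(1) by (simp add: z_def)
    qed
    moreover have "z \<in> ball x r"
      using dist_triangle[of x z y] y(2) yz_le \<rho> by simp
    moreover have "p \<in> ball x r"
    proof -
      have "p - x = (y - x) + t *\<^sub>R v + u" by (simp add: u_def)
      then have "norm (p - x) \<le> norm (y - x) + t * norm v + norm u"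
        using norm_triangle_ineq[of "y - x + t *\<^sub>R v" u] norm_triangle_ineq[of "y - x" "t *\<^sub>R v"] t(1)
        by (simp only: norm_scaleR abs_of_nonneg)
      also have "\<dots> < r / 4 + t * (norm v + \<epsilon>) + r / 4"
        using y(2) u \<rho> by (simp add: R_def dist_norm norm_minus_commute algebra_simps)
      finally show ?thesis using t(2) \<rho> by (simp add: dist_norm norm_minus_commute)
    qed
    moreover have "norm (p - z - t *\<^sub>R v) \<le> t * \<epsilon>"
    proof -
      have "p - z - t *\<^sub>R v = (1 - \<rho> / R) *\<^sub>R u" by (simp add: z_def u_def algebra_simps)
      also have "1 - \<rho> / R = t * \<epsilon> / R" using R by (simp add: R_def field_simps)
      finally have "norm (p - z - t *\<^sub>R v) = t * \<epsilon> * (norm u / R)"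
        using R t(1) \<epsilon> by simp
      also have "\<dots> \<le> t * \<epsilon> * 1" using R u t(1) \<epsilon> by (intro mult_left_mono) auto
      finally show ?thesis by simp
    qed
    ultimately have "p \<in> N" using cone t(1) cone_closed_nearD by blast
    then show False using p by simp
  qed
  then have "\<rho> + t * \<epsilon> \<le> infdist (y + t *\<^sub>R v) (- N)"
    using ne by (subst infdist_notempty) (auto intro!: cINF_greatest)
  then show ?thesis by (simp add: \<rho>_def)
qed

section \<open>Representation by the signed distance\<close>

definition signed_dist :: "'a::metric_space set \<Rightarrow> 'a \<Rightarrow> real" where
  "signed_dist M x = infdist x M - infdist x (- M)"

lemma lipschitz_around_signed_dist: "lipschitz_around S (signed_dist M) x"
proof -
  have "2-lipschitz_on (ball x 1 \<inter> S) (signed_dist M)"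
  proof (rule lipschitz_onI)
    show "dist (signed_dist M y) (signed_dist M z) \<le> 2 * dist y z" for y z
      using infdist_triangle_abs[of y M z] infdist_triangle_abs[of y "- M" z]
      by (simp add: signed_dist_def dist_real_def)
  qed simp
  then show ?thesis unfolding lipschitz_around_def by (intro exI[of _ 1]) auto
qed

text \<open>Since \<open>infdist\<close> to the empty set is 0, the signed distance vanishes
  identically both for \<open>M = UNIV\<close>, which it then represents, and for
  \<open>M = {}\<close>, which it does not.\<close>

lemma signed_dist_le_0_iff:
  assumes "closed M" "M \<noteq> {}"
  shows "signed_dist M x \<le> 0 \<longleftrightarrow> x \<in> M"
proof (cases "x \<in> M")
  case True
  then show ?thesis by (simp add: signed_dist_def infdist_nonneg)
next
  case False
  then have "infdist x M > 0"
    using assms in_closed_iff_infdist_zero[of M x] infdist_nonneg[of x M] by linarith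
  then show ?thesis using False by (simp add: signed_dist_def)
qed

text \<open>Along \<open>v\<close> the distance to the complement grows inside \<open>M\<close> and
  the distance to \<open>M\<close> shrinks outside, both at rate \<open>\<epsilon>\<close>. A
  segment entering \<open>M\<close> is cut at its first point in \<open>M\<close>.\<close>

lemma zero_notin_clarke_gradient_signed_dist:
  fixes M :: "'a::banach set"
  assumes "closed M" "epi_lipschitzian_at M x" "x \<in> frontier M"
  shows "0 \<notin> clarke_gradient (signed_dist M) x"
proof -
  obtain r v \<epsilon> where r: "r > 0" and \<epsilon>: "\<epsilon> > 0" and cone: "cone_closed_near x r v \<epsilon> M"
    using epi_lipschitzian_at_cone[OF assms(2)] by blast
  have cone': "cone_closed_near x r (- v) \<epsilon> (- M)" using cone by (rule cone_closed_near_Compl)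
  have x: "x \<in> closure (- M)" "x \<in> closure (- (- M))"
    using assms(3) by (auto simp: frontier_def closure_complement)
  define n where "n = norm v + \<epsilon>"
  have n: "n > 0" using \<epsilon> by (simp add: n_def add_nonneg_pos)
  have shift: "y + t *\<^sub>R v \<in> ball x (r / 4)" if "y \<in> ball x (r / 8)" "t \<ge> 0" "t * n \<le> r / 8" for y t
  proof -
    have "norm (x - (y + t *\<^sub>R v)) \<le> norm (x - y) + t * norm v"
      using norm_triangle_ineq4[of "x - y" "t *\<^sub>R v"] that(2) by (simp add: algebra_simps)
    moreover have "t * norm v \<le> t * n" using that(2) \<epsilon> by (intro mult_left_mono) (auto simp: n_def)
    ultimately show ?thesis using that by (simp add: dist_norm)
  qed
  have inside: "y + t *\<^sub>R v \<in> M \<and> signed_dist M (y + t *\<^sub>R v) \<le> signed_dist M y - \<epsilon> * t"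
    if y: "y \<in> M" "y \<in> ball x (r / 4)" "y + t *\<^sub>R v \<in> ball x (r / 4)" and t: "t \<ge> 0" "t * n \<le> r / 4" for y t
  proof -
    have "y + t *\<^sub>R v \<in> M"
      by (rule cone_closed_nearD[OF cone y(1) _ _ t(1)]) (use y t \<epsilon> r in auto)
    then show ?thesis
      using infdist_Compl_cone[OF cone \<epsilon> x(1) y(1,2) t(1)] t(2) y(1)
      by (simp add: signed_dist_def n_def mult.commute)
  qed
  \<comment> \<open>The growth estimate for the complement is read backwards, from
    \<open>y + t *\<^sub>R v\<close> along \<open>- v\<close> to \<open>y\<close>.\<close>
  have outside: "signed_dist M (y + t *\<^sub>R v) \<le> signed_dist M y - \<epsilon> * t"
    if y: "y \<notin> M" "y + t *\<^sub>R v \<notin> M" "y + t *\<^sub>R v \<in> ball x (r / 4)" and t: "t \<ge> 0" "t * n \<le> r / 4" for y t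
    using infdist_Compl_cone[OF cone' \<epsilon> x(2), of "y + t *\<^sub>R v" t] y t
    by (simp add: signed_dist_def n_def mult.commute)
  have "signed_dist M (y + t *\<^sub>R v) \<le> signed_dist M y - \<epsilon> * t"
    if y: "y \<in> ball x (r / 8)" and t: "0 < t" "t * n \<le> r / 8" for y t
  proof -
    have y4: "y \<in> ball x (r / 4)" using y r by auto
    have tn: "s * n \<le> r / 8" if "s \<le> t" for s
      using that t(2) mult_right_mono[OF that less_imp_le[OF n]] by linarith
    consider "y \<in> M" | "y \<notin> M" "y + t *\<^sub>R v \<notin> M" | "y \<notin> M" "y + t *\<^sub>R v \<in> M" by blast
    then show ?thesis
    proof cases
      case 1
      then show ?thesis using inside[OF 1 y4 shift] y t r by simp
    next
      case 2
      then show ?thesis using outside[OF 2 shift] y t r by simp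
    next
      case 3
      define T where "T = {s \<in> {0..t}. y + s *\<^sub>R v \<in> M}"
      define s where "s = Inf T"
      have "closed T"
      proof -
        have "closed ((\<lambda>s. y + s *\<^sub>R v) -` M \<inter> {0..t})"
          by (intro closed_vimage_Int assms(1) continuous_intros closed_real_atLeastAtMost)
        moreover have "T = (\<lambda>s. y + s *\<^sub>R v) -` M \<inter> {0..t}" by (auto simp: T_def)
        ultimately show ?thesis by simp
      qed
      moreover have "t \<in> T" using 3 t by (simp add: T_def)
      moreover have bdd: "bdd_below T" by (intro bdd_belowI[of _ 0]) (auto simp: T_def)
      ultimately have "s \<in> T" unfolding s_def by (intro closed_contains_Inf) auto
      then have s: "0 \<le> s" "s \<le> t" "y + s *\<^sub>R v \<in> M" by (auto simp: T_def)
      have s0: "s > 0" using s 3(1) by (cases "s = 0") auto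
      \<comment> \<open>The entry point itself is in \<open>M\<close>, so the outside estimate is
        used at earlier parameters \<open>a\<close>, where the signed distance is still nonnegative;
        then \<open>a\<close> tends to \<open>s\<close>.\<close>
      have "\<epsilon> * a \<le> signed_dist M y" if a: "0 < a" "a < s" for a
      proof -
        have "a \<notin> T" using cInf_lower[OF _ bdd, of a] a(2) by (auto simp: s_def)
        then have aM: "y + a *\<^sub>R v \<notin> M" using a s(2) by (simp add: T_def)
        have "signed_dist M (y + a *\<^sub>R v) \<le> signed_dist M y - \<epsilon> * a"
          using outside[OF 3(1) aM shift] y a s(2) tn[of a] r by simp
        moreover have "signed_dist M (y + a *\<^sub>R v) \<ge> 0"
          using aM by (simp add: signed_dist_def infdist_nonneg)
        ultimately show ?thesis by simp
      qed
      then have "s \<le> signed_dist M y / \<epsilon>"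
        using s0 \<epsilon> by (intro dense_le_bounded[of 0 s]) (auto simp: field_simps)
      then have 1: "\<epsilon> * s \<le> signed_dist M y" using \<epsilon> by (simp add: field_simps)
      have eq: "y + s *\<^sub>R v + (t - s) *\<^sub>R v = y + t *\<^sub>R v" by (simp add: algebra_simps)
      have "signed_dist M (y + t *\<^sub>R v) \<le> signed_dist M (y + s *\<^sub>R v) - \<epsilon> * (t - s)"
        using inside[OF s(3) shift, of "t - s"] shift[of y t] y s t tn[of s] tn[of "t - s"] r
        unfolding eq by simp
      moreover have "signed_dist M (y + s *\<^sub>R v) \<le> 0"
        using s(3) by (simp add: signed_dist_def infdist_nonneg)
      ultimately show ?thesis using 1 by (simp add: algebra_simps)
    qed
  qed
  moreover have "t * n \<le> r / 8" if "t < r / (8 * n)" for t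
    using that n by (simp add: field_simps)
  ultimately show ?thesis
    unfolding zero_notin_clarke_gradient_iff using \<epsilon> r n
    by (intro exI[of _ v] exI[of _ \<epsilon>] exI[of _ "min (r / 8) (r / (8 * n))"] conjI ballI allI impI) auto
qed

theorem theorem1:
  fixes M :: "'a::banach set"
  assumes "(UNIV :: 'a set) \<noteq> {0}"
    and "closed M"
  shows "epi_lipschitzian M \<longleftrightarrow>
    (\<exists>f :: 'a \<Rightarrow> real. locally_lipschitz f \<and> M = {x. f x \<le> 0} \<and>
       (\<forall>x\<in>frontier M. 0 \<notin> clarke_gradient f x))"
    (is "_ \<longleftrightarrow> (\<exists>f. ?P f)")
proof
  assume epi: "epi_lipschitzian M"
  show "\<exists>f. ?P f"
  proof (cases "M = {}")
    \<comment> \<open>The signed distance of the empty set is the zero function, hence the positive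
      constant.\<close>
    case True
    have "locally_lipschitz (\<lambda>_ :: 'a. 1 :: real)"
      unfolding locally_lipschitz_def lipschitz_around_def
      by (intro allI exI[of _ 1] conjI exI[of _ 0] lipschitz_onI) auto
    then show ?thesis using True by (intro exI[of _ "\<lambda>_. 1"]) auto
  next
    case False
    have "locally_lipschitz (signed_dist M)"
      by (simp add: locally_lipschitz_def lipschitz_around_signed_dist)
    moreover have "M = {x. signed_dist M x \<le> 0}"
      using signed_dist_le_0_iff[OF assms(2) False] by auto
    moreover have "0 \<notin> clarke_gradient (signed_dist M) x" if "x \<in> frontier M" for x
      using that epi assms(2) frontier_subset_closed[OF assms(2)]
      by (intro zero_notin_clarke_gradient_signed_dist) (auto simp: epi_lipschitzian_def)
    ultimately show ?thesis by blast
  qed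
next
  assume "\<exists>f. ?P f"
  then obtain f :: "'a \<Rightarrow> real" where lip: "\<And>x. lipschitz_around UNIV f x"
    and M: "M = {x. f x \<le> 0}" and grad: "\<And>x. x \<in> frontier M \<Longrightarrow> 0 \<notin> clarke_gradient f x"
    by (auto simp: locally_lipschitz_def)
  \<comment> \<open>A nonzero vector provides the real factor of a chart; the zero space admits no
    chart, even for \<open>M = UNIV\<close>.\<close>
  obtain v :: 'a where v: "v \<noteq> 0" using assms(1) by blast
  have cont: "continuous_on UNIV f"
  proof (rule continuous_at_imp_continuous_on, rule ballI)
    fix x
    obtain e L where e: "e > 0" "L-lipschitz_on (ball x e) f"
      using lip[of x] unfolding lipschitz_around_def by auto
    then have "continuous_on (ball x e) f" by (intro lipschitz_on_continuous_on)
    then show "isCont f x" using e(1) by (simp add: continuous_on_eq_continuous_at)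
  qed
  have "epi_lipschitzian_at M x" if x: "x \<in> M" for x
  proof (cases "x \<in> interior M")
    case True
    then show ?thesis using v by (intro epi_lipschitzian_at_interior)
  next
    case False
    \<comment> \<open>By continuity negative values occur only in the interior, so a remaining point
      of \<open>M\<close> is at level 0 and on the frontier, where nondegeneracy applies.\<close>
    have "open {x. f x < 0}" by (intro open_Collect_less cont continuous_intros)
    then have "{x. f x < 0} \<subseteq> interior M" by (intro interior_maximal) (auto simp: M)
    then have "f x = 0" using False x M by force
    moreover have "x \<in> frontier M" using False x closure_subset by (auto simp: frontier_def)
    ultimately show ?thesis
      unfolding M using epi_lipschitzian_at_level_set lip grad M by blast
  qed
  then show "epi_lipschitzian M" by (simp add: epi_lipschitzian_def)
qed

end
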